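(* Let $n\ge 5$ and let $h\in A_n$ be an element of the permutation group $S_n$. Then the class $[e]_h$, formed in $S_n$, is not a subgroup of $S_n$.
   Context: $S_n$ is the group of permutations of $n$ symbols and $A_n\le S_n$ is the alternating group of even permutations. For $h\in S_n$, $[e]_h=\{z^{-1}h^{-1}zh\mid z\in S_n\}$ is the twisted conjugacy class of the unit element $e$ with respect to the inner automorphism $x\mapsto h^{-1}xh$ of $S_n$.
   Formalization: The formal statement additionally assumes that h is not the unit element e; for h = e the class [e]_e = {e} is the trivial subgroup, so the claim as worded fails exactly in that case. *)

theory Defs
  imports "HOL-Algebra.Sym_Groups"
begin

definition inner_aut :: "('a, 'b) monoid_scheme \<Rightarrow> 'a \<Rightarrow> 'a \<Rightarrow> 'a"
  where "inner_aut G h x = inv\<^bsub>G\<^esub> h \<otimes>\<^bsub>G\<^esub> x \<otimes>\<^bsub>G\<^esub> h"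

text \<open>
  The orbit of \<open>x\<close> under the twisted conjugation \<open>x \<mapsto> z\<inverse> x \<phi>(z)\<close>.
  Some authors write \<open>z x \<phi>(z)\<inverse>\<close>; this gives the same set when \<open>\<phi>\<close> is a homomorphism.
\<close>
definition twisted_conj_class :: "('a, 'b) monoid_scheme \<Rightarrow> ('a \<Rightarrow> 'a) \<Rightarrow> 'a \<Rightarrow> 'a set"
  where "twisted_conj_class G \<phi> x =
    {inv\<^bsub>G\<^esub> z \<otimes>\<^bsub>G\<^esub> x \<otimes>\<^bsub>G\<^esub> \<phi> z | z. z \<in> carrier G}"

definition unit_class :: "('a, 'b) monoid_scheme \<Rightarrow> 'a \<Rightarrow> 'a set"
  where "unit_class G h = twisted_conj_class G (inner_aut G h) \<one>\<^bsub>G\<^esub>"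

lemma (in group) unit_class_eq:
  assumes "h \<in> carrier G"
  shows "unit_class G h = {inv z \<otimes> inv h \<otimes> z \<otimes> h | z. z \<in> carrier G}"
proof -
  have "inv z \<otimes> \<one> \<otimes> inner_aut G h z = inv z \<otimes> inv h \<otimes> z \<otimes> h" if "z \<in> carrier G" for z
    using that assms by (simp add: inner_aut_def m_assoc)
  then show ?thesis
    unfolding unit_class_def twisted_conj_class_def by (metis (lifting))
qed

text \<open>For \<open>h = \<one>\<close> the class is the trivial subgroup, so this case has to be excluded
  from any claim that the class is not a subgroup.\<close>

lemma (in group) unit_class_one: "unit_class G \<one> = {\<one>}"
  unfolding unit_class_eq[OF one_closed] by (auto intro!: exI[of _ \<one>])

lemma (in group) subgroup_unit_class_one: "subgroup (unit_class G \<one>) G"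
  unfolding unit_class_one by (rule triv_subgroup)

end

theory Submission
  imports Defs
begin

text \<open>
  Write \<open>H\<close> for the class \<open>[e]\<^sub>h\<close> and \<open>C\<close> for the ordinary conjugacy class of \<open>h\<^sup>-\<^sup>1\<close>,
  so that \<open>H = C h\<close>. Suppose that \<open>H\<close> is a subgroup of \<open>S\<^sub>n\<close>. Then \<open>C = H h\<^sup>-\<^sup>1\<close> is a coset of
  \<open>H\<close> that is stable under conjugation, and this forces \<open>H\<close> to be normal
  (\<open>unit_class_subgroup_imp_normal\<close>). For \<open>n \<ge> 5\<close> a normal subgroup of \<open>S\<^sub>n\<close> is trivial or contains
  \<open>A\<^sub>n\<close> (\<open>alt_group_subset_normal\<close>), and both cases lead to \<open>h = e\<close>. If \<open>H\<close> is trivial, then \<open>h\<close>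
  is central, but the centre of \<open>S\<^sub>n\<close> is trivial (\<open>sym_group_central_imp_id\<close>). If
  \<open>A\<^sub>n \<subseteq> H\<close>, then \<open>h \<in> H = C h\<close> because \<open>h\<close> is even; hence \<open>e \<in> C\<close>, and the class of \<open>e\<close> is a
  single point (\<open>mem_unit_class_self_imp_one\<close>).
\<close>

section \<open>The twisted class of the unit in an arbitrary group\<close>

text \<open>The class consists of the commutators of \<open>h\<close> with all group elements. Conjugating such a
  commutator by \<open>x\<close> gives the commutator with \<open>z x\<^sup>-\<^sup>1\<close> in place of \<open>z\<close>, up to a right factor
  which is the inverse of the commutator belonging to \<open>x\<^sup>-\<^sup>1\<close>.\<close>

lemma (in group) unit_class_subgroup_imp_normal:
  assumes h: "h \<in> carrier G" and sub: "subgroup (unit_class G h) G"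
  shows "unit_class G h \<lhd> G"
proof -
  have "x \<otimes> u \<otimes> inv x \<in> unit_class G h"
    if x: "x \<in> carrier G" and u: "u \<in> unit_class G h" for x u
  proof -
    obtain z where z: "z \<in> carrier G" "u = inv z \<otimes> inv h \<otimes> z \<otimes> h"
      using u unfolding unit_class_eq[OF h] by blast
    let ?c = "\<lambda>z. inv z \<otimes> inv h \<otimes> z \<otimes> h"
    have c: "?c y \<in> unit_class G h" if "y \<in> carrier G" for y
      using that unfolding unit_class_eq[OF h] by blast
    have "x \<otimes> u \<otimes> inv x = ?c (z \<otimes> inv x) \<otimes> inv (?c (inv x))"
      using x z h by (simp add: inv_mult_group m_assoc inv_solve_left inv_solve_right)
        (simp add: m_assoc[symmetric])
    moreover have "?c (z \<otimes> inv x) \<in> unit_class G h" "?c (inv x) \<in> unit_class G h"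
      using x z c by blast+
    ultimately show ?thesis
      using subgroup.m_closed[OF sub] subgroup.m_inv_closed[OF sub] by simp
  qed
  then show ?thesis using sub normal_inv_iff by blast
qed

lemma (in group) mem_unit_class_self_imp_one:
  assumes h: "h \<in> carrier G" and mem: "h \<in> unit_class G h"
  shows "h = \<one>"
proof -
  obtain z where z: "z \<in> carrier G" "h = inv z \<otimes> inv h \<otimes> z \<otimes> h"
    using mem unfolding unit_class_eq[OF h] by blast
  have "inv z \<otimes> inv h \<otimes> z = \<one>"
    using z h by (metis inv_closed m_closed r_cancel_one')
  then have "inv h \<otimes> z = z"
    using z h by (metis inv_closed inv_equality inv_inv m_assoc m_closed inv_comm)
  then have "inv h = \<one>" using z h by simp
  then show ?thesis using h by (metis inv_inv inv_one)
qed

section \<open>Normal subgroups of symmetric groups\<close>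

text \<open>If \<open>p\<close> moves \<open>a\<close>, it does not commute with a transposition that moves \<open>p a\<close> and fixes \<open>a\<close>.\<close>

lemma sym_group_central_imp_id:
  fixes n :: nat
  assumes n: "n \<ge> 3" and p: "p permutes {1..n}"
    and central: "\<And>q. q permutes {1..n} \<Longrightarrow> p \<circ> q = q \<circ> p"
  shows "p = id"
proof (rule ccontr)
  assume "p \<noteq> id"
  then obtain a where a: "p a \<noteq> a" by (auto simp: fun_eq_iff)
  then have mem: "a \<in> {1..n}" "p a \<in> {1..n}"
    using p by (metis permutes_not_in, metis permutes_in_image permutes_not_in)
  have "\<not> {1..n} \<subseteq> {a, p a}"
    using n card_mono[of "{a, p a}" "{1..n}"] card_insert_le_m1[of 2 "{p a}" a] by auto
  then obtain c where c: "c \<in> {1..n}" "c \<noteq> a" "c \<noteq> p a" by blast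
  have "(p \<circ> transpose (p a) c) a = (transpose (p a) c \<circ> p) a"
    using central[OF permutes_swap_id[OF mem(2) c(1)]] by simp
  then show False using a c by simp
qed

lemma permutes_extending_map:
  assumes "finite S" "distinct xs" "distinct ys" "length xs = length ys"
    and "set xs \<subseteq> S" "set ys \<subseteq> S"
  obtains q where "q permutes S" "map q xs = ys"
proof -
  have "card (S - set xs) = card (S - set ys)"
    using assms by (simp add: card_Diff_subset distinct_card)
  then obtain g where g: "bij_betw g (S - set xs) (S - set ys)"
    using assms(1) by (metis bij_betw_iff_card finite_Diff)
  define f where "f = (\<lambda>x. the (map_of (zip xs ys) x))"
  have map_f: "map f xs = ys"
    using assms(2,4) by (intro nth_equalityI) (auto simp: f_def map_of_zip_nth)
  have f: "bij_betw f (set xs) (set ys)"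
    unfolding bij_betw_def using map_f assms(2,3) by (metis distinct_map set_map)
  define q where "q = (\<lambda>x. if x \<in> set xs then f x else if x \<in> S then g x else x)"
  have "bij_betw q (set xs) (set ys)"
    using f by (rule bij_betw_cong[THEN iffD1, rotated]) (auto simp: q_def)
  moreover have "bij_betw q (S - set xs) (S - set ys)"
    using g by (rule bij_betw_cong[THEN iffD1, rotated]) (auto simp: q_def)
  ultimately have "bij_betw q (set xs \<union> (S - set xs)) (set ys \<union> (S - set ys))"
    by (rule bij_betw_combine) auto
  then have "bij_betw q S S"
    using assms(5,6) by (simp add: Un_absorb1)
  then have "q permutes S"
    using assms(5) by (intro bij_imp_permutes) (auto simp: q_def)
  moreover have "map q xs = ys"
    using map_f by (auto simp: q_def)
  ultimately show thesis by (rule that)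
qed

text \<open>All 3-cycles are conjugate in \<open>S\<^sub>n\<close>, and they generate \<open>A\<^sub>n\<close>.\<close>

lemma alt_group_subset_normal_if_three_cycle:
  assumes N: "N \<lhd> sym_group n"
    and abc: "distinct [a, b, c]" "{a, b, c} \<subseteq> {1..n}" "cycle_of_list [a, b, c] \<in> N"
  shows "carrier (alt_group n) \<subseteq> N"
proof -
  interpret G: group "sym_group n" by (rule sym_group_is_group)
  have "three_cycles n \<subseteq> N"
  proof
    fix p assume "p \<in> three_cycles n"
    then obtain cs where cs: "p = cycle_of_list cs" "distinct cs" "length cs = 3" "set cs \<subseteq> {1..n}"
      by auto
    obtain q where q: "q permutes {1..n}" "map q [a, b, c] = cs"
      using permutes_extending_map[of "{1..n}" "[a, b, c]" cs] abc(1,2) cs by auto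
    then have "q \<circ> cycle_of_list [a, b, c] \<circ> inv' q = p"
      using conjugation_of_cycle[OF abc(1) permutes_bij[OF q(1)]] cs(1) by (simp add: o_assoc)
    moreover have "q \<circ> cycle_of_list [a, b, c] \<circ> inv' q \<in> N"
      using G.normal_invE(2)[OF N _ abc(3), of q] q(1)
      by (simp add: sym_group_carrier sym_group_mult)
    ultimately show "p \<in> N" by simp
  qed
  then have "generate (sym_group n) (three_cycles n) \<subseteq> N"
    using G.generate_subgroup_incl G.normal_invE(1)[OF N] by blast
  moreover have "carrier (alt_group n) = generate (sym_group n) (three_cycles n)"
    using G.generate_consistent[OF three_cycles_incl alt_group_is_subgroup]
      alt_group_carrier_as_three_cycles[of n]
    by (simp add: alt_group_def)
  ultimately show ?thesis by simp
qed

text \<open>With \<open>t = (x y)\<close>, the product is the commutator \<open>t p t\<^sup>-\<^sup>1 p\<^sup>-\<^sup>1\<close>, since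
  \<open>p t p\<^sup>-\<^sup>1 = (p x  p y)\<close>.\<close>

lemma transpose_mult_conj_mem_normal:
  assumes N: "N \<lhd> sym_group n" and p: "p \<in> N" and xy: "x \<in> {1..n}" "y \<in> {1..n}"
  shows "transpose x y \<circ> transpose (p x) (p y) \<in> N"
proof -
  interpret G: group "sym_group n" by (rule sym_group_is_group)
  interpret N: normal N "sym_group n" by (rule N)
  let ?t = "transpose x y"
  have t: "?t \<in> carrier (sym_group n)"
    using permutes_swap_id[OF xy] by (simp add: sym_group_carrier)
  have pc: "p \<in> carrier (sym_group n)" using p N.subset by blast
  then have bij: "bij p" by (simp add: sym_group_carrier permutes_bij)
  have "?t \<circ> p \<circ> ?t \<circ> inv' p \<in> N"
    using N.m_closed[OF N.inv_op_closed2[OF t p] N.m_inv_closed[OF p]] t pc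
    by (simp add: sym_group_mult)
  moreover have "transpose (p x) (p y) \<circ> p = p \<circ> ?t"
    using transpose_comp_eq[OF bij] bij by (simp add: bij_is_inj)
  then have "p \<circ> ?t \<circ> inv' p = transpose (p x) (p y)"
    by (metis bij bij_is_surj comp_assoc comp_id surj_iff)
  ultimately show ?thesis by (simp add: comp_assoc)
qed

text \<open>By the previous lemma each \<open>p \<in> N\<close> yields many products of two transpositions in \<open>N\<close>;
  when the two overlap in exactly one point, the product is a 3-cycle. Let \<open>p\<close> move \<open>a\<close> to \<open>b\<close>.
  If \<open>p b \<noteq> a\<close>, the pair \<open>a, b\<close> gives such an overlap, and if \<open>p\<close> swaps \<open>a\<close> and \<open>b\<close> but fixes a
  third point \<open>c\<close>, the pair \<open>a, c\<close> does. Otherwise the pair \<open>a, c\<close> gives the double transposition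
  \<open>(a c)(b d)\<close> with \<open>d = p c\<close>. Here a fifth point \<open>e\<close> is needed: \<open>(a c)(b e)\<close> is a conjugate,
  and in the product of both the common factor \<open>(a c)\<close> cancels, which leaves a 3-cycle on
  \<open>b, d, e\<close>.\<close>

theorem alt_group_subset_normal:
  assumes n: "n \<ge> 5" and N: "N \<lhd> sym_group n" and nontriv: "N \<noteq> {\<one>\<^bsub>sym_group n\<^esub>}"
  shows "carrier (alt_group n) \<subseteq> N"
proof -
  interpret G: group "sym_group n" by (rule sym_group_is_group)
  interpret N: normal N "sym_group n" by (rule N)
  have fresh: "\<exists>x \<in> {1..n}. x \<notin> set xs" if "length xs \<le> 4" for xs
  proof (rule ccontr)
    assume "\<not> ?thesis"
    then have "{1..n} \<subseteq> set xs" by blast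
    then have "n \<le> card (set xs)" using card_mono[of "set xs" "{1..n}"] by simp
    then show False using n that card_length[of xs] by linarith
  qed
  obtain p where p: "p \<in> N" "p \<noteq> id"
    using nontriv N.one_closed by (auto simp: sym_group_one)
  then have perm: "p permutes {1..n}" using N.subset by (auto simp: sym_group_carrier)
  note closed = transpose_mult_conj_mem_normal[OF N p(1)]
  note in_range = permutes_in_image[OF perm]
  note inj = permutes_inj[OF perm, THEN inj_eq]
  obtain a where a: "p a \<noteq> a" using p(2) by (auto simp: fun_eq_iff)
  then have mem_a: "a \<in> {1..n}" using perm by (metis permutes_not_in)
  define b where "b = p a"
  have mem_b: "b \<in> {1..n}" using mem_a in_range b_def by simp
  have "\<exists>x y z. distinct [x, y, z] \<and> {x, y, z} \<subseteq> {1..n} \<and> cycle_of_list [x, y, z] \<in> N"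
  proof (cases "p b = a")
    case False
    then have "distinct [a, b, p b]" using a inj by (auto simp: b_def)
    moreover have "cycle_of_list [a, b, p b] \<in> N"
      using closed[OF mem_a mem_b] by (simp add: b_def)
    ultimately show ?thesis using mem_a mem_b in_range by blast
  next
    case True
    obtain c where c: "c \<in> {1..n}" "c \<noteq> a" "c \<noteq> b"
      using fresh[of "[a, b]"] by auto
    define d where "d = p c"
    have d: "d \<in> {1..n}" "d \<noteq> a" "d \<noteq> b"
      using c(1) in_range inj[of c b] inj[of c a] c(2,3) True by (simp_all add: d_def b_def)
    have acbd: "transpose a c \<circ> transpose b d \<in> N"
      using closed[OF mem_a c(1)] by (simp add: b_def d_def)
    show ?thesis
    proof (cases "d = c")
      case True
      then have "cycle_of_list [a, c, b] \<in> N"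
        using acbd by (simp add: transpose_commute)
      then show ?thesis using a c mem_a mem_b b_def
        by (intro exI[of _ a] exI[of _ c] exI[of _ b]) auto
    next
      case False
      obtain e where e: "e \<in> {1..n}" "e \<noteq> a" "e \<noteq> b" "e \<noteq> c" "e \<noteq> d"
        using fresh[of "[a, b, c, d]"] by auto
      let ?t = "transpose d e"
      have t: "?t \<in> carrier (sym_group n)"
        using permutes_swap_id[OF d(1) e(1)] by (simp add: sym_group_carrier)
      have "?t \<circ> (transpose a c \<circ> transpose b d) \<circ> ?t \<in> N"
        using N.inv_op_closed2[OF t acbd] t by (simp add: sym_group_mult)
      then have "(transpose a c \<circ> transpose b d) \<circ>
          (?t \<circ> (transpose a c \<circ> transpose b d) \<circ> ?t) \<in> N"
        using N.m_closed[OF acbd] by (simp add: sym_group_mult)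
      moreover have "(transpose a c \<circ> transpose b d) \<circ>
          (?t \<circ> (transpose a c \<circ> transpose b d) \<circ> ?t) = cycle_of_list [d, b, e]"
        using a c d e False by (auto simp: fun_eq_iff b_def[symmetric] transpose_def)
      ultimately show ?thesis using d e mem_b
        by (intro exI[of _ d] exI[of _ b] exI[of _ e]) auto
    qed
  qed
  then show ?thesis using alt_group_subset_normal_if_three_cycle[OF N] by blast
qed

section \<open>The twisted class of the unit in the symmetric group\<close>

theorem proposition11:
  fixes n :: nat and h :: "nat \<Rightarrow> nat"
  assumes "n \<ge> 5"
    and "h \<in> carrier (alt_group n)"
    and "h \<noteq> \<one>\<^bsub>sym_group n\<^esub>"
  shows "\<not> subgroup (unit_class (sym_group n) h) (sym_group n)"
proof
  interpret G: group "sym_group n" by (rule sym_group_is_group)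
  let ?H = "unit_class (sym_group n) h"
  assume sub: "subgroup ?H (sym_group n)"
  have h: "h \<in> carrier (sym_group n)"
    using assms(2) by (simp add: alt_group_carrier sym_group_carrier)
  have normal: "?H \<lhd> sym_group n"
    using G.unit_class_subgroup_imp_normal[OF h sub] .
  show False
  proof (cases "?H = {\<one>\<^bsub>sym_group n\<^esub>}")
    case True
    have "h \<circ> q = q \<circ> h" if "q permutes {1..n}" for q
    proof -
      have q: "q \<in> carrier (sym_group n)" using that by (simp add: sym_group_carrier)
      then have "inv\<^bsub>sym_group n\<^esub> q \<otimes>\<^bsub>sym_group n\<^esub> inv\<^bsub>sym_group n\<^esub> h
          \<otimes>\<^bsub>sym_group n\<^esub> q \<otimes>\<^bsub>sym_group n\<^esub> h = \<one>\<^bsub>sym_group n\<^esub>"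
        using True unfolding G.unit_class_eq[OF h] by blast
      then have "inv\<^bsub>sym_group n\<^esub> (h \<otimes>\<^bsub>sym_group n\<^esub> q)
          \<otimes>\<^bsub>sym_group n\<^esub> (q \<otimes>\<^bsub>sym_group n\<^esub> h) = \<one>\<^bsub>sym_group n\<^esub>"
        using q h by (simp add: G.inv_mult_group G.m_assoc del: sym_group_inv_equality)
      then have "h \<otimes>\<^bsub>sym_group n\<^esub> q = q \<otimes>\<^bsub>sym_group n\<^esub> h"
        using q h by (metis G.inv_closed G.inv_equality G.inv_inv G.m_closed G.inv_comm)
      then show ?thesis by (simp add: sym_group_mult)
    qed
    then have "h = id"
      using sym_group_central_imp_id[of n h] assms(1) h by (simp add: sym_group_carrier)
    then show False using assms(3) by (simp add: sym_group_one)
  next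
    case False
    then have "h \<in> ?H"
      using alt_group_subset_normal[OF assms(1) normal] assms(2) by blast
    then show False
      using G.mem_unit_class_self_imp_one[OF h] assms(3) by blast
  qed
qed

end
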